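(* Let $T$ be a tree of diameter $d$ and let $D$ be a target distribution on $T$ of size $t\ge 1$. Then $\pi(T,D)\le \pi_t(T)-s(D)+1$. Furthermore, if $C$ is a configuration on $T$ of size $|C|\ge \pi_t(T)-s(D)+1$, then for every vertex $v$ with $D(v)>0$, $C$ solves $v$ with cost at most $2^{\mathrm{ecc}_T(v)}$.
   Context: A configuration on a connected graph $G$ is a function $C:V(G)\to\mathbb{N}$ (number of pebbles on each vertex), of size $|C|=\sum_v C(v)$. A pebbling step from a vertex $u$ with $C(u)\ge 2$ to a neighbor $w$ removes two pebbles from $u$ and adds one pebble to $w$. For a vertex $r$, $C$ is $t$-fold $r$-solvable if some sequence of pebbling steps places at least $t$ pebbles on $r$; $\pi_t(G,r)$ is the least $m$ such that every configuration of size $m$ is $t$-fold $r$-solvable, and $\pi_t(G)=\max_r \pi_t(G,r)$. A target distribution is a function $D:V(G)\to\mathbb{N}$, of size $|D|=\sum_v D(v)$; $C$ is $D$-solvable if some sequence of pebbling steps results in at least $D(v)$ pebbles on each vertex $v$ simultaneously, and $\pi(G,D)$ is the least $m$ such that every configuration of size at least $m$ is $D$-solvable. $s(D)$ denotes the number of vertices $v$ with $D(v)>0$. For an $r$-solution $\sigma$ (a sequence of $c$ pebbling steps placing a pebble on $r$), its cost is $c+1$; "$C$ solves $v$ with cost at most $x$" means there is a sequence of pebbling steps from $C$ placing a pebble on $v$ whose cost is at most $x$. $\mathrm{ecc}_T(v)$ is the maximum distance in $T$ from $v$ to another vertex. *)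

theory Defs
  imports "Graph_Theory.Digraph_Component"
begin

text \<open>
  Undirected finite simple graphs are the symmetric digraphs of the locale
  \<open>graph\<close>; every edge is a pair of opposite arcs. The library's \<open>forest\<close> and \<open>tree\<close>
  forbid directed cycles and thus already exclude the back-and-forth walk along
  a single edge. The cycles of the underlying undirected graph are exactly the
  directed cycles of length at least 3. \<open>connected\<close> includes that the
  vertex set is nonempty.
\<close>

definition undirected_tree :: "('a, 'b) pre_digraph \<Rightarrow> bool" where
  "undirected_tree G \<longleftrightarrow>
     graph G \<and> Digraph_Component.connected G \<and>
     \<not> (\<exists>p. pre_digraph.cycle G p \<and> 3 \<le> length p)"

definition graph_dist :: "('a, 'b) pre_digraph \<Rightarrow> 'a \<Rightarrow> 'a \<Rightarrow> nat" where
  "graph_dist G u v = (LEAST n. \<exists>p. pre_digraph.awalk G u p v \<and> length p = n)"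

text \<open>
  The vertex itself is included, at distance 0, so that the eccentricity
  in a one-vertex graph is 0.
\<close>

definition ecc :: "('a, 'b) pre_digraph \<Rightarrow> 'a \<Rightarrow> nat" where
  "ecc G v = Max (graph_dist G v ` verts G)"

definition graph_diameter :: "('a, 'b) pre_digraph \<Rightarrow> nat" where
  "graph_diameter G = Max {graph_dist G u v | u v. u \<in> verts G \<and> v \<in> verts G}"

text \<open>
  Configurations and target distributions are functions on the whole vertex type; all
  notions below depend only on their values on \<open>verts G\<close>.
\<close>

definition conf_size :: "('a, 'b) pre_digraph \<Rightarrow> ('a \<Rightarrow> nat) \<Rightarrow> nat" where
  "conf_size G C = (\<Sum>v\<in>verts G. C v)"

definition pebbling_step :: "('a, 'b) pre_digraph \<Rightarrow> ('a \<Rightarrow> nat) \<Rightarrow> ('a \<Rightarrow> nat) \<Rightarrow> bool" where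
  "pebbling_step G C C' \<longleftrightarrow>
     (\<exists>u w. u \<rightarrow>\<^bsub>G\<^esub> w \<and> 2 \<le> C u \<and> C' = C(u := C u - 2, w := C w + 1))"

definition fold_solvable :: "('a, 'b) pre_digraph \<Rightarrow> nat \<Rightarrow> 'a \<Rightarrow> ('a \<Rightarrow> nat) \<Rightarrow> bool" where
  "fold_solvable G t r C \<longleftrightarrow> (\<exists>C'. (pebbling_step G)\<^sup>*\<^sup>* C C' \<and> t \<le> C' r)"

definition rooted_pebbling_number :: "('a, 'b) pre_digraph \<Rightarrow> nat \<Rightarrow> 'a \<Rightarrow> nat" where
  "rooted_pebbling_number G t r =
     (LEAST m. \<forall>C. conf_size G C = m \<longrightarrow> fold_solvable G t r C)"

definition fold_pebbling_number :: "('a, 'b) pre_digraph \<Rightarrow> nat \<Rightarrow> nat" where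
  "fold_pebbling_number G t = Max (rooted_pebbling_number G t ` verts G)"

definition target_solvable ::
    "('a, 'b) pre_digraph \<Rightarrow> ('a \<Rightarrow> nat) \<Rightarrow> ('a \<Rightarrow> nat) \<Rightarrow> bool" where
  "target_solvable G D C \<longleftrightarrow>
     (\<exists>C'. (pebbling_step G)\<^sup>*\<^sup>* C C' \<and> (\<forall>v\<in>verts G. D v \<le> C' v))"

definition target_pebbling_number :: "('a, 'b) pre_digraph \<Rightarrow> ('a \<Rightarrow> nat) \<Rightarrow> nat" where
  "target_pebbling_number G D =
     (LEAST m. \<forall>C. m \<le> conf_size G C \<longrightarrow> target_solvable G D C)"

definition support_size :: "('a, 'b) pre_digraph \<Rightarrow> ('a \<Rightarrow> nat) \<Rightarrow> nat" where
  "support_size G D = card {v \<in> verts G. 0 < D v}"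

text \<open>A solution with \<open>c\<close> pebbling steps has cost \<open>c + 1\<close>.\<close>

definition solves_with_cost_at_most ::
    "('a, 'b) pre_digraph \<Rightarrow> ('a \<Rightarrow> nat) \<Rightarrow> 'a \<Rightarrow> nat \<Rightarrow> bool" where
  "solves_with_cost_at_most G C v x \<longleftrightarrow>
     (\<exists>c C'. (pebbling_step G ^^ c) C C' \<and> 1 \<le> C' v \<and> c + 1 \<le> x)"

end

theory Submission
  imports Defs "HOL-Library.Function_Algebras"
begin

text \<open>
  Root the tree at \<open>r\<close>, let \<open>h\<^sub>r(u)\<close> be the height of the subtree hanging from \<open>u\<close>, and let
  \<open>w(r) = (\<Sum>u \<noteq> r. 2 ^ h\<^sub>r(u))\<close>. Then \<open>\<pi>\<^sub>t(T, r) = w(r) + (t - 1) 2 ^ ecc(r) + 1\<close>.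

  Upper bound: cut the configuration into pieces, each of which can be collected into a single
  pebble on some vertex \<open>u\<close> at cost at most \<open>2 ^ h\<^sub>r(u)\<close>. Two pieces collected on the same \<open>u \<noteq> r\<close>
  merge into one on the parent of \<open>u\<close>, so in a smallest set of pieces every \<open>u \<noteq> r\<close> occurs at most
  once; more than \<open>w(r)\<close> pebbles therefore yield a piece on \<open>r\<close>, of cost at most \<open>2 ^ ecc(r)\<close>.
  Empty leaves carry no piece, so each of them lowers the threshold by one.

  Lower bound: one pebble on every \<open>u \<noteq> r\<close> and \<open>t - 1\<close> pebbles on \<open>r\<close> do not allow \<open>t\<close> pebbles on
  \<open>r\<close>. Replacing a pebble by two pebbles on a child preserves this, and doing so down to deepest
  leaves gives an unsolvable configuration of size \<open>w(r) + (t - 1) 2 ^ ecc(r)\<close>.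

  Moving the root shows that \<open>w\<close> is maximal at a vertex of eccentricity \<open>d\<close>, hence
  \<open>\<pi>\<^sub>t(T) = max w + (t - 1) 2 ^ d + 1\<close>. The targets are now served one after another. A target costs
  at most \<open>2 ^ d\<close>, and less than \<open>2 ^ d\<close> if it already carries a pebble or has eccentricity below
  \<open>d\<close>; when neither helps and no target is required twice, all targets are empty leaves, and these
  make up for the missing \<open>s(D) - 1\<close> pebbles.
\<close>

section \<open>Distances\<close>

unbundle no funcset_syntax

context wf_digraph
begin

lemma graph_dist_le_length: "awalk u p v \<Longrightarrow> graph_dist G u v \<le> length p"
  unfolding graph_dist_def by (rule Least_le) blast

lemma shortest_awalkE:
  assumes "u \<rightarrow>\<^sup>* v"
  obtains p where "awalk u p v" "length p = graph_dist G u v"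
proof -
  have "\<exists>n p. awalk u p v \<and> length p = n" using assms by (auto simp: reachable_awalk)
  from LeastI_ex[OF this] show thesis using that unfolding graph_dist_def by blast
qed

lemma graph_dist_self [simp]: "u \<in> verts G \<Longrightarrow> graph_dist G u u = 0"
  using graph_dist_le_length[of u "[]" u] by (simp add: awalk_Nil_iff)

lemma graph_dist_eq_0_iff: "u \<rightarrow>\<^sup>* v \<Longrightarrow> graph_dist G u v = 0 \<longleftrightarrow> u = v"
  by (rule shortest_awalkE[of u v]) (auto simp: awalk_Nil_iff)

lemma graph_dist_triangle:
  assumes "u \<rightarrow>\<^sup>* v" "v \<rightarrow>\<^sup>* w"
  shows "graph_dist G u w \<le> graph_dist G u v + graph_dist G v w"
proof -
  obtain p where walk_uv: "awalk u p v" "length p = graph_dist G u v"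
    using shortest_awalkE[OF assms(1)] .
  obtain q where walk_vw: "awalk v q w" "length q = graph_dist G v w"
    using shortest_awalkE[OF assms(2)] .
  show ?thesis
    using graph_dist_le_length[OF awalk_appendI[OF walk_uv(1) walk_vw(1)]] walk_uv(2) walk_vw(2)
    by simp
qed

lemma adj_imp_awalk: "u \<rightarrow> w \<Longrightarrow> \<exists>e. awalk u [e] w"
  by (auto simp: arcs_ends_conv awalk_simps)

lemma graph_dist_adj_le: "u \<rightarrow> w \<Longrightarrow> graph_dist G u w \<le> 1"
  by (auto dest!: adj_imp_awalk graph_dist_le_length)

lemma graph_dist_Suc_adj:
  assumes "u \<rightarrow>\<^sup>* v" "v \<rightarrow> w"
  shows "graph_dist G u w \<le> Suc (graph_dist G u v)"
  using graph_dist_triangle[OF assms(1) reachable_adjI[OF assms(2)]] graph_dist_adj_le[OF assms(2)]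
  by simp

lemma graph_dist_lastE:
  assumes "u \<rightarrow>\<^sup>* v" "u \<noteq> v"
  obtains w where "w \<rightarrow> v" "graph_dist G u v = Suc (graph_dist G u w)"
proof -
  obtain p where walk: "awalk u p v" "length p = graph_dist G u v"
    using shortest_awalkE[OF assms(1)] .
  obtain q e where split: "p = q @ [e]"
    using walk(1) assms(2) by (cases p rule: rev_cases) (auto simp: awalk_Nil_iff)
  then have init: "awalk u q (tail G e)" and last_arc: "tail G e \<rightarrow> v"
    using walk(1) by (auto simp: awalk_simps arcs_ends_conv)
  moreover have "graph_dist G u v = Suc (graph_dist G u (tail G e))"
    using graph_dist_le_length[OF init] graph_dist_Suc_adj[OF reachable_awalkI[OF init] last_arc]
      walk(2) split by simp
  ultimately show thesis using that by blast
qed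

lemma graph_dist_via_shortest_awalk:
  assumes "awalk u p v" "length p = graph_dist G u v" "x \<in> set (awalk_verts u p)"
  shows "graph_dist G u v = graph_dist G u x + graph_dist G x v"
proof -
  obtain q s where split: "p = q @ s" "awalk u q x" "awalk x s v"
    using awalk_decomp[OF assms(1,3)] by blast
  have "graph_dist G u v \<le> graph_dist G u x + graph_dist G x v"
    using split by (intro graph_dist_triangle) (auto intro: reachable_awalkI)
  then show ?thesis
    using graph_dist_le_length[OF split(2)] graph_dist_le_length[OF split(3)] assms(2) split(1)
    by simp
qed

end

context sym_digraph
begin

lemma awalk_rev: "awalk u p v \<Longrightarrow> \<exists>q. awalk v q u \<and> length q = length p"
proof (induction p arbitrary: u)
  case Nil
  then show ?case by (auto simp: awalk_Nil_iff)
next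
  case (Cons e p)
  then obtain q where rev_walk: "awalk v q (head G e)" "length q = length p"
    by (auto simp: awalk_Cons_iff)
  have "u \<rightarrow> head G e" using Cons.prems by (auto simp: awalk_Cons_iff arcs_ends_conv)
  then have "head G e \<rightarrow> u" by (rule graph_symmetric)
  then obtain f where "awalk (head G e) [f] u" using adj_imp_awalk by blast
  then have "awalk v (q @ [f]) u" using rev_walk(1) awalk_appendI by blast
  then show ?case using rev_walk(2) by (intro exI[of _ "q @ [f]"]) simp
qed

lemma graph_dist_commute: "graph_dist G u v = graph_dist G v u"
proof -
  have "(\<exists>p. awalk u p v \<and> length p = n) \<longleftrightarrow> (\<exists>p. awalk v p u \<and> length p = n)" for n
    using awalk_rev by metis
  then show ?thesis by (simp add: graph_dist_def)
qed

end

context fin_digraph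
begin

lemma graph_dist_le_ecc: "x \<in> verts G \<Longrightarrow> graph_dist G v x \<le> ecc G v"
  by (simp add: ecc_def)

lemma ecc_attainedE:
  assumes "v \<in> verts G"
  obtains x where "x \<in> verts G" "graph_dist G v x = ecc G v"
proof -
  have "ecc G v \<in> graph_dist G v ` verts G" unfolding ecc_def using assms by (intro Max_in) auto
  then show thesis using that by auto
qed

lemma graph_diameter_eq_Max_ecc:
  assumes "verts G \<noteq> {}"
  shows "graph_diameter G = Max (ecc G ` verts G)"
proof (rule antisym)
  let ?D = "{graph_dist G u v |u v. u \<in> verts G \<and> v \<in> verts G}"
  have "?D = (\<lambda>(u, v). graph_dist G u v) ` (verts G \<times> verts G)" by auto
  then have distances: "finite ?D" "?D \<noteq> {}" using assms by auto
  show "graph_diameter G \<le> Max (ecc G ` verts G)"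
    unfolding graph_diameter_def
  proof (intro Max.boundedI distances, safe)
    fix u v assume "u \<in> verts G" "v \<in> verts G"
    then have "graph_dist G u v \<le> ecc G u" by (intro graph_dist_le_ecc)
    also have "\<dots> \<le> Max (ecc G ` verts G)" using \<open>u \<in> verts G\<close> by simp
    finally show "graph_dist G u v \<le> Max (ecc G ` verts G)" .
  qed
  have "ecc G u \<le> graph_diameter G" if vert: "u \<in> verts G" for u
  proof -
    obtain x where "x \<in> verts G" "graph_dist G u x = ecc G u" using ecc_attainedE[OF vert] .
    then have "ecc G u \<in> ?D" using vert by (intro CollectI exI[of _ u] exI[of _ x]) simp
    then show ?thesis unfolding graph_diameter_def by (intro Max_ge distances)
  qed
  then show "Max (ecc G ` verts G) \<le> graph_diameter G" using assms by simp
qed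

lemma ecc_le_diameter: "v \<in> verts G \<Longrightarrow> ecc G v \<le> graph_diameter G"
  by (subst graph_diameter_eq_Max_ecc) auto

lemma power_ecc_le_power_diameter: "v \<in> verts G \<Longrightarrow> (2::nat) ^ ecc G v \<le> 2 ^ graph_diameter G"
  using ecc_le_diameter by (intro power_increasing) auto

lemma graph_dist_le_diameter:
  "u \<in> verts G \<Longrightarrow> v \<in> verts G \<Longrightarrow> graph_dist G u v \<le> graph_diameter G"
  using graph_dist_le_ecc ecc_le_diameter by (blast intro: le_trans)

definition periphery :: "'a set" where
  "periphery = {v \<in> verts G. ecc G v = graph_diameter G}"

lemma periphery_subset: "periphery \<subseteq> verts G"
  by (auto simp: periphery_def)

lemma finite_periphery [simp]: "finite periphery"
  by (simp add: periphery_def)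

lemma periphery_nonempty:
  assumes "verts G \<noteq> {}"
  shows "periphery \<noteq> {}"
proof -
  have "Max (ecc G ` verts G) \<in> ecc G ` verts G" using assms by (intro Max_in) auto
  then show ?thesis by (auto simp: periphery_def graph_diameter_eq_Max_ecc[OF assms])
qed

end

section \<open>Rooted trees\<close>

locale tree_graph = graph +
  assumes undirected_tree: "undirected_tree G"
begin

abbreviation gdist :: "'a \<Rightarrow> 'a \<Rightarrow> nat" where
  "gdist \<equiv> graph_dist G"

lemma strongly_connected: "strongly_connected G"
  using undirected_tree symmetric_connected_imp_strongly_connected[OF sym_arcs]
  by (simp add: undirected_tree_def)

lemma verts_nonempty: "verts G \<noteq> {}"
  using strongly_connected by (simp add: strongly_connected_def)

lemma verts_reachable [simp]: "u \<in> verts G \<Longrightarrow> v \<in> verts G \<Longrightarrow> u \<rightarrow>\<^sup>* v"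
  using strongly_connected by (simp add: strongly_connected_def)

lemma awalk_between_neighbours:
  assumes "u \<rightarrow> w" "w' \<rightarrow> u" "w \<noteq> w'" "awalk w p w'"
  shows "u \<in> set (awalk_verts w p)"
proof (rule ccontr)
  assume avoids_p: "u \<notin> set (awalk_verts w p)"
  define q where "q = awalk_to_apath p"
  have path: "apath w q w'" "set q \<subseteq> set p"
    unfolding q_def using assms(4) apath_awalk_to_apath awalk_to_apath_subset by blast+
  have path_walk: "awalk w q w'" "distinct (awalk_verts w q)"
    using path(1) by (auto simp: apath_def)
  have avoids_path: "u \<notin> set (awalk_verts w q)"
    using avoids_p path(2)
    unfolding set_awalk_verts[OF path_walk(1)] set_awalk_verts[OF assms(4)] by auto
  obtain e where first_arc: "e \<in> arcs G" "tail G e = u" "head G e = w"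
    using assms(1) by (auto simp: arcs_ends_conv)
  obtain f where last_arc: "f \<in> arcs G" "tail G f = w'" "head G f = u"
    using assms(2) by (auto simp: arcs_ends_conv)
  have walk_to_u: "awalk w (q @ [f]) u"
    using last_arc by (intro awalk_appendI[OF path_walk(1)]) (auto simp: awalk_simps)
  have "awalk_verts w (q @ [f]) = awalk_verts w q @ [u]"
    using awalk_verts_append[OF walk_to_u] last_arc by simp
  then have "distinct (awalk_verts w (q @ [f]))" using avoids_path path_walk(2) by simp
  moreover have "awalk u (e # q @ [f]) u"
    using first_arc walk_to_u by (simp only: awalk_Cons_iff)
  ultimately have "cycle (e # q @ [f])"
    unfolding cycle_def using first_arc by (intro exI[of _ u]) auto
  moreover have "q \<noteq> []" using path_walk(1) assms(3) by (auto simp: awalk_Nil_iff)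
  then have "3 \<le> length (e # q @ [f])" by (cases q) auto
  ultimately show False using undirected_tree by (auto simp: undirected_tree_def)
qed

text \<open>
  The walk from \<open>a\<close> via \<open>v\<close> and \<open>x\<close> to \<open>b\<close> must pass through \<open>z\<close>, but its two outer parts are too
  short to do so.
\<close>

lemma gdist_branch:
  assumes branches: "z \<rightarrow> a" "z \<rightarrow> b" "a \<noteq> b" and ends: "v \<in> verts G" "x \<in> verts G"
    and closer: "gdist v a \<le> gdist v z" "gdist x b \<le> gdist x z"
  shows "gdist v x = gdist v z + gdist z x"
proof -
  have verts: "z \<in> verts G" "a \<in> verts G" "b \<in> verts G" using branches adj_in_verts by auto
  obtain p where walk_av: "awalk a p v" "length p = gdist a v"
    using shortest_awalkE[OF verts_reachable[OF verts(2) ends(1)]] .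
  obtain q where walk_vx: "awalk v q x" "length q = gdist v x"
    using shortest_awalkE[OF verts_reachable[OF ends]] .
  obtain s where walk_xb: "awalk x s b" "length s = gdist x b"
    using shortest_awalkE[OF verts_reachable[OF ends(2) verts(3)]] .
  have "awalk a (p @ q @ s) b" using walk_av(1) walk_vx(1) walk_xb(1) by (meson awalk_appendI)
  then have "z \<in> set (awalk_verts a (p @ q @ s))"
    using awalk_between_neighbours[OF branches(1) graph_symmetric[OF branches(2)] branches(3)]
    by blast
  then consider (first) "z \<in> set (awalk_verts a p)" | (middle) "z \<in> set (awalk_verts v q)"
    | (last) "z \<in> set (awalk_verts x s)"
    using set_awalk_verts_append[OF walk_av(1) awalk_appendI[OF walk_vx(1) walk_xb(1)]]
      set_awalk_verts_append[OF walk_vx(1) walk_xb(1)] by auto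
  then show ?thesis
  proof cases
    case first
    then have "gdist a z = 0"
      using graph_dist_via_shortest_awalk[OF walk_av first] closer(1)
      by (simp add: graph_dist_commute)
    then have "a = z" using graph_dist_eq_0_iff[of a z] verts by simp
    then show ?thesis using branches(1) adj_not_same by blast
  next
    case middle
    then show ?thesis using graph_dist_via_shortest_awalk[OF walk_vx] by blast
  next
    case last
    then have "gdist z b = 0" using graph_dist_via_shortest_awalk[OF walk_xb last] closer(2) by simp
    then have "z = b" using graph_dist_eq_0_iff[of z b] verts by simp
    then show ?thesis using branches(2) adj_not_same by blast
  qed
qed

lemma closer_neighbour_unique:
  assumes root: "r \<in> verts G" and adj: "u \<rightarrow> a" "u \<rightarrow> b"
    and closer: "gdist r a \<le> gdist r u" "gdist r b \<le> gdist r u"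
  shows "a = b"
proof (rule ccontr)
  assume "a \<noteq> b"
  have verts: "u \<in> verts G" "a \<in> verts G" using adj adj_in_verts by auto
  have "gdist r u = 0" using gdist_branch[OF adj \<open>a \<noteq> b\<close> root root closer] root by simp
  then have "u = a" using closer(1) graph_dist_eq_0_iff[of r] root verts by auto
  then show False using adj(1) adj_not_same by blast
qed

definition children :: "'a \<Rightarrow> 'a \<Rightarrow> 'a set" where
  "children r u = {x. u \<rightarrow> x \<and> gdist r x = Suc (gdist r u)}"

lemma children_adj:
  assumes "x \<in> children r u"
  shows "u \<rightarrow> x" "x \<rightarrow> u" "u \<in> verts G" "x \<in> verts G"
  using assms adj_in_verts graph_symmetric by (auto simp: children_def)

lemma finite_children [simp]: "finite (children r u)"
  by (rule finite_subset[OF _ finite_verts]) (auto dest: children_adj)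

lemma gdist_child: "x \<in> children r u \<Longrightarrow> gdist r x = Suc (gdist r u)"
  by (simp add: children_def)

lemma gdist_parent:
  assumes "x \<in> children r u"
  shows "gdist u x = 1"
proof -
  have "gdist u x \<noteq> 0"
    using graph_dist_eq_0_iff[of u x] children_adj[OF assms] gdist_child[OF assms] by auto
  then show ?thesis using graph_dist_adj_le[OF children_adj(1)[OF assms]] by simp
qed

lemma self_not_child: "u \<notin> children r u"
  by (simp add: children_def)

lemma root_not_child: "r \<in> verts G \<Longrightarrow> r \<notin> children r u"
  by (simp add: children_def)

lemma parentE:
  assumes "r \<in> verts G" "x \<in> verts G" "x \<noteq> r"
  obtains u where "x \<in> children r u"
proof -
  obtain u where "u \<rightarrow> x" "gdist r x = Suc (gdist r u)" using graph_dist_lastE[of r x] assms by auto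
  then show thesis using that by (simp add: children_def)
qed

lemma parent_unique:
  assumes "r \<in> verts G" "x \<in> children r u" "x \<in> children r w"
  shows "u = w"
proof (rule closer_neighbour_unique[OF assms(1)])
  show "x \<rightarrow> u" "x \<rightarrow> w" using assms(2,3) children_adj by blast+
  show "gdist r u \<le> gdist r x" "gdist r w \<le> gdist r x" using assms(2,3) gdist_child by fastforce+
qed

lemma adj_children_cases:
  assumes root: "r \<in> verts G" and adj: "u \<rightarrow> w"
  obtains (child) "w \<in> children r u" | (parent) "u \<in> children r w"
proof -
  have verts: "u \<in> verts G" "w \<in> verts G" and adj_back: "w \<rightarrow> u"
    using adj adj_in_verts graph_symmetric by auto
  have "gdist r u \<noteq> gdist r w"
  proof
    assume same_level: "gdist r u = gdist r w"
    have "u \<noteq> r" using same_level root verts graph_dist_eq_0_iff[of r w] adj adj_not_same by auto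
    then obtain p where parent: "u \<in> children r p" using parentE[OF root verts(1)] by blast
    then have "w = p"
      using closer_neighbour_unique[OF root adj children_adj(2)[OF parent]] same_level
        gdist_child[OF parent] by simp
    then show False using same_level gdist_child[OF parent] by simp
  qed
  moreover have "gdist r w \<le> Suc (gdist r u)" "gdist r u \<le> Suc (gdist r w)"
    using graph_dist_Suc_adj root verts adj adj_back by auto
  ultimately consider "gdist r w = Suc (gdist r u)" | "gdist r u = Suc (gdist r w)" by linarith
  then show thesis using that adj adj_back by cases (auto simp: children_def)
qed

lemma rooted_induct [consumes 2, case_names root child]:
  assumes root_vert: "r \<in> verts G" and "z \<in> verts G" and root: "P r"
    and child: "\<And>u x. x \<in> children r u \<Longrightarrow> P u \<Longrightarrow> P x"
  shows "P z"
  using assms(2)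
proof (induction "gdist r z" arbitrary: z rule: less_induct)
  case less
  show ?case
  proof (cases "z = r")
    case False
    then obtain u where parent: "z \<in> children r u" using parentE[OF root_vert less.prems] by blast
    then show ?thesis
      using child less.hyps[of u] gdist_child[OF parent] children_adj(3)[OF parent] by simp
  qed (simp add: root)
qed

definition subtree :: "'a \<Rightarrow> 'a \<Rightarrow> 'a set" where
  "subtree r u = {z \<in> verts G. gdist r z = gdist r u + gdist u z}"

definition height :: "'a \<Rightarrow> 'a \<Rightarrow> nat" where
  "height r u = Max (gdist u ` subtree r u)"

lemma finite_subtree [simp]: "finite (subtree r u)"
  by (simp add: subtree_def)

lemma gdist_le_height: "z \<in> subtree r u \<Longrightarrow> gdist u z \<le> height r u"
  by (simp add: height_def)

lemma height_attainedE:
  assumes "u \<in> verts G"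
  obtains z where "z \<in> subtree r u" "gdist u z = height r u"
proof -
  have "u \<in> subtree r u" using assms by (simp add: subtree_def)
  then have "height r u \<in> gdist u ` subtree r u" unfolding height_def by (intro Max_in) auto
  then show thesis using that by auto
qed

lemma height_root: "r \<in> verts G \<Longrightarrow> height r r = ecc G r"
proof -
  assume "r \<in> verts G"
  then have "subtree r r = verts G" by (auto simp: subtree_def)
  then show ?thesis by (simp add: height_def ecc_def)
qed

lemma gdist_parent_subtree:
  assumes root: "r \<in> verts G" and child: "x \<in> children r u" and below: "z \<in> subtree r x"
  shows "gdist u z = Suc (gdist x z)"
proof (rule antisym)
  have verts: "u \<in> verts G" "x \<in> verts G" "z \<in> verts G"
    using children_adj[OF child] below by (auto simp: subtree_def)
  show "gdist u z \<le> Suc (gdist x z)"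
    using graph_dist_triangle[of u x z] graph_dist_adj_le[OF children_adj(1)[OF child]] verts
    by simp
  show "Suc (gdist x z) \<le> gdist u z"
    using graph_dist_triangle[of r u z] gdist_child[OF child] below root verts
    by (simp add: subtree_def)
qed

lemma subtree_child_subset:
  assumes "r \<in> verts G" and child: "x \<in> children r u"
  shows "subtree r x \<subseteq> subtree r u"
  using gdist_parent_subtree[OF assms] gdist_child[OF child] by (auto simp: subtree_def)

lemma height_child_less:
  assumes "r \<in> verts G" and child: "x \<in> children r u"
  shows "height r x < height r u"
proof -
  obtain z where deepest: "z \<in> subtree r x" "gdist x z = height r x"
    using height_attainedE children_adj(4)[OF child] by blast
  then have "gdist u z \<le> height r u" using subtree_child_subset[OF assms] gdist_le_height by blast
  then show ?thesis using gdist_parent_subtree[OF assms deepest(1)] deepest(2) by simp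
qed

lemma subtree_parent_root:
  assumes root: "r \<in> verts G" and child: "x \<in> children r u"
  shows "subtree r x = subtree u x"
proof (intro equalityI subsetI)
  have verts: "u \<in> verts G" "x \<in> verts G" using children_adj[OF child] by auto
  show "z \<in> subtree u x" if "z \<in> subtree r x" for z
    using gdist_parent_subtree[OF root child that] gdist_parent[OF child] that
    by (simp add: subtree_def)
  fix z assume "z \<in> subtree u x"
  then have below: "z \<in> verts G" "gdist u z = Suc (gdist x z)"
    using gdist_parent[OF child] by (auto simp: subtree_def)
  show "z \<in> subtree r x"
  proof (cases "z = x")
    case False
    then obtain b where towards_z: "x \<in> children z b" using parentE[OF below(1) verts(2)] by blast
    have "u \<noteq> b"
      using gdist_child[OF towards_z] below(2) by (auto simp: graph_dist_commute)
    then have "gdist r z = gdist r x + gdist x z"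
      using gdist_branch[OF children_adj(2)[OF child] children_adj(2)[OF towards_z] _ root below(1)]
        gdist_child[OF child] gdist_child[OF towards_z] by simp
    then show ?thesis using below(1) by (simp add: subtree_def)
  qed (use verts in \<open>simp add: subtree_def\<close>)
qed

lemma height_parent_root:
  assumes "r \<in> verts G" "x \<in> children r u"
  shows "height r x = height u x"
  unfolding height_def subtree_parent_root[OF assms] ..

lemma height_adjacent_root:
  assumes adj: "r \<rightarrow> r'" and vert: "u \<in> verts G" "u \<noteq> r" "u \<noteq> r'"
  shows "height r u = height r' u"
proof -
  have roots: "r \<in> verts G" "r' \<in> verts G" using adj adj_in_verts by auto
  obtain p where above: "u \<in> children r p" using parentE[OF roots(1) vert(1,2)] by blast
  from roots(2) children_adj(1)[OF above] have "u \<in> children r' p"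
  proof (cases rule: adj_children_cases)
    case parent
    have "r \<in> subtree u p"
      using gdist_child[OF above] gdist_parent[OF parent] roots
      by (simp add: subtree_def graph_dist_commute)
    then have "r \<in> subtree r' p" using subtree_parent_root[OF roots(2) parent] by simp
    then have "gdist r' r = gdist r' p + gdist p r" by (simp add: subtree_def)
    then have "gdist r' u = 0"
      using graph_dist_adj_le[OF adj] gdist_child[OF parent] by (simp add: graph_dist_commute)
    then show ?thesis using graph_dist_eq_0_iff[of r' u] roots vert by simp
  qed
  then show ?thesis using height_parent_root[OF _ above] height_parent_root[of r' u p] roots by simp
qed

definition weight :: "'a \<Rightarrow> nat" where
  "weight r = (\<Sum>u\<in>verts G - {r}. 2 ^ height r u)"

definition max_weight :: nat where
  "max_weight = Max (weight ` verts G)"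

lemma weight_le_max_weight: "v \<in> verts G \<Longrightarrow> weight v \<le> max_weight"
  by (simp add: max_weight_def)

lemma weight_adjacent_root:
  assumes adj: "r \<rightarrow> r'"
  shows "weight r + 2 ^ height r' r = weight r' + 2 ^ height r r'"
proof -
  have roots: "r \<in> verts G" "r' \<in> verts G" "r \<noteq> r'" using adj adj_in_verts adj_not_same by auto
  let ?rest = "\<lambda>x. \<Sum>u\<in>verts G - {r, r'}. 2 ^ height x u :: nat"
  have "verts G - {r} - {r'} = verts G - {r, r'}" "verts G - {r'} - {r} = verts G - {r, r'}" by auto
  then have "weight r = 2 ^ height r r' + ?rest r" "weight r' = 2 ^ height r' r + ?rest r'"
    using roots sum.remove[of "verts G - {r}" r' "\<lambda>u. 2 ^ height r u"]
      sum.remove[of "verts G - {r'}" r "\<lambda>u. 2 ^ height r' u"] by (simp_all add: weight_def)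
  moreover have "?rest r = ?rest r'"
    using height_adjacent_root[OF adj] by (intro sum.cong) auto
  ultimately show ?thesis by simp
qed

lemma weight_child_root:
  assumes root: "v \<in> verts G" and child: "z \<in> children v p"
    and parent_bound: "weight v + 2 ^ height v p \<le> weight p + 2 ^ ecc G v"
  shows "weight v + 2 ^ height v z + 2 ^ height z p \<le> weight z + 2 ^ ecc G v"
proof -
  have "(2::nat) ^ Suc (height v z) \<le> 2 ^ height v p"
    using height_child_less[OF root child] by (intro power_increasing) auto
  then show ?thesis
    using weight_adjacent_root[OF children_adj(1)[OF child]] height_parent_root[OF root child]
      parent_bound by simp
qed

lemma weight_any_root:
  assumes root: "v \<in> verts G" and vert: "z \<in> verts G"
  shows "weight v + 2 ^ height v z \<le> weight z + 2 ^ ecc G v"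
  using root vert
proof (induction rule: rooted_induct)
  case root
  then show ?case by (simp add: height_root assms(1))
next
  case (child p z)
  then show ?case using weight_child_root[OF root] by fastforce
qed

lemma child_towards_antipode:
  assumes "x \<in> verts G" "gdist u x = graph_diameter G" "u \<rightarrow> c"
  shows "u \<in> children x c"
  using assms(1,3)
proof (cases rule: adj_children_cases)
  case child
  then show ?thesis
    using graph_dist_le_diameter[OF assms(1), of c] gdist_child[OF child] children_adj(4)[OF child]
      assms(2)
    by (simp add: graph_dist_commute)
qed

lemma peripheral_neighbour_unique:
  assumes "u \<in> periphery" "u \<rightarrow> a" "u \<rightarrow> b"
  shows "a = b"
proof -
  obtain x where antipode: "x \<in> verts G" "gdist u x = graph_diameter G"
    using assms(1) ecc_attainedE[of u] by (auto simp: periphery_def)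
  then show ?thesis
    using parent_unique[OF antipode(1)] child_towards_antipode[OF antipode] assms(2,3) by blast
qed

lemma height_peripheral:
  assumes root: "r \<in> verts G" and peripheral: "u \<in> periphery" "u \<noteq> r"
  shows "height r u = 0"
proof (rule ccontr)
  assume "height r u \<noteq> 0"
  have u_vert: "u \<in> verts G" using peripheral(1) periphery_subset by blast
  obtain z where deepest: "z \<in> subtree r u" "gdist u z = height r u"
    using height_attainedE[OF u_vert] .
  have z_vert: "z \<in> verts G" and "u \<noteq> z"
    using deepest \<open>height r u \<noteq> 0\<close> u_vert by (auto simp: subtree_def)
  obtain p where parent: "u \<in> children r p" using parentE[OF root u_vert peripheral(2)] .
  obtain b where towards_z: "u \<in> children z b" using parentE[OF z_vert u_vert \<open>u \<noteq> z\<close>] .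
  have "p = b"
    using peripheral_neighbour_unique[OF peripheral(1)] children_adj(2)[OF parent]
      children_adj(2)[OF towards_z] by blast
  then show False
    using graph_dist_triangle[of r p z] gdist_child[OF parent] gdist_child[OF towards_z] deepest(1)
      children_adj(3)[OF parent] root z_vert by (simp add: subtree_def graph_dist_commute)
qed

lemma weight_le_peripheral:
  assumes inner: "v \<in> verts G" "v \<notin> periphery" and peripheral: "y \<in> periphery"
  shows "weight v \<le> weight y"
proof -
  have y_vert: "y \<in> verts G" using peripheral periphery_subset by blast
  obtain p where parent: "y \<in> children v p"
    using parentE[OF inner(1) y_vert] inner(2) peripheral by blast
  obtain x where antipode: "x \<in> verts G" "gdist y x = graph_diameter G"
    using peripheral ecc_attainedE[OF y_vert] by (auto simp: periphery_def)
  have dist_antipode: "gdist y x = Suc (gdist p x)"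
    using gdist_child[OF child_towards_antipode[OF antipode children_adj(2)[OF parent]]]
    by (simp add: graph_dist_commute)
  then have "x \<in> subtree y p"
    using gdist_parent[OF parent] antipode(1) by (simp add: subtree_def graph_dist_commute)
  then have "gdist p x \<le> height y p" by (rule gdist_le_height)
  moreover have "ecc G v < graph_diameter G"
    using inner ecc_le_diameter[OF inner(1)] by (simp add: periphery_def)
  \<comment> \<open>The last step onto \<open>y\<close> alone gains \<open>2 ^ (d - 1)\<close>, more than the path from \<open>v\<close> can lose.\<close>
  ultimately have "(2::nat) ^ ecc G v \<le> 2 ^ height y p"
    using dist_antipode antipode(2) by (intro power_increasing) auto
  moreover have "weight v + 2 ^ height v y + 2 ^ height y p \<le> weight y + 2 ^ ecc G v"
    using weight_any_root[OF inner(1) children_adj(3)[OF parent]]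
    by (rule weight_child_root[OF inner(1) parent])
  ultimately show ?thesis by linarith
qed

lemma max_weight_peripheralE:
  obtains y where "y \<in> periphery" "weight y = max_weight"
proof -
  have "max_weight \<in> weight ` verts G"
    unfolding max_weight_def using verts_nonempty by (intro Max_in) auto
  then obtain v where maximal: "v \<in> verts G" "weight v = max_weight" by force
  obtain y where peripheral: "y \<in> periphery" using periphery_nonempty[OF verts_nonempty] by blast
  show thesis
  proof (cases "v \<in> periphery")
    case False
    have "y \<in> verts G" using peripheral periphery_subset by blast
    then have "weight y = max_weight"
      using weight_le_peripheral[OF maximal(1) False peripheral] weight_le_max_weight maximal(2)
      by (simp add: antisym)
    then show thesis using that peripheral by blast
  qed (use that maximal(2) in blast)
qed

end

section \<open>Moving pebbles\<close>

definition pebbles :: "nat \<Rightarrow> 'a \<Rightarrow> 'a \<Rightarrow> nat" where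
  "pebbles n v = (\<lambda>x. if x = v then n else 0)"

lemma pebbles_self [simp]: "pebbles n v v = n"
  by (simp add: pebbles_def)

lemma pebbles_0 [simp]: "pebbles 0 v = 0"
  by (auto simp: pebbles_def)

lemma pebbles_add: "pebbles (m + n) v = pebbles m v + pebbles n v"
  by (auto simp: pebbles_def)

lemma conf_size_0 [simp]: "conf_size G 0 = 0"
  by (simp add: conf_size_def)

lemma conf_size_add [simp]: "conf_size G (C + R) = conf_size G C + conf_size G R"
  by (simp add: conf_size_def sum.distrib)

lemma conf_size_sum [simp]: "conf_size G (\<Sum>i\<in>I. C i) = (\<Sum>i\<in>I. conf_size G (C i))"
  by (induction I rule: infinite_finite_induct) (simp_all del: plus_fun_apply zero_fun_apply)

lemma conf_size_sum_mset: "conf_size G (\<Sum>\<^sub># M) = (\<Sum>C\<in>#M. conf_size G C)"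
  by (induction M) (simp_all del: plus_fun_apply zero_fun_apply)

lemma le_imp_eq_add_diff: "c \<le> C \<Longrightarrow> C = c + (\<lambda>x. C x - c x)" for C :: "'a \<Rightarrow> nat"
  by (auto simp: le_fun_def)

context fin_digraph
begin

lemma conf_size_pebbles [simp]: "v \<in> verts G \<Longrightarrow> conf_size G (pebbles n v) = n"
  by (simp add: conf_size_def pebbles_def)

lemma conf_remove_pebbleE:
  assumes "0 < conf_size G C"
  obtains v R where "v \<in> verts G" "C = pebbles 1 v + R"
proof -
  have "\<exists>v\<in>verts G. 0 < C v"
    using assms unfolding conf_size_def by (metis gr0I less_irrefl sum.neutral)
  then obtain v where occupied: "v \<in> verts G" "0 < C v" by blast
  then have "C = pebbles 1 v + (\<lambda>x. C x - pebbles 1 v x)"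
    by (intro le_imp_eq_add_diff) (auto simp: pebbles_def le_fun_def)
  then show thesis using that occupied(1) by blast
qed

lemma conf_splitE:
  assumes "m \<le> conf_size G C"
  obtains C' R where "C = C' + R" "conf_size G C' = m"
proof -
  have "\<exists>C' R. C = C' + R \<and> conf_size G C' = m"
    using assms
  proof (induction m)
    case 0
    have "C = 0 + C" by simp
    then show ?case using conf_size_0 by blast
  next
    case (Suc m)
    then obtain C' R where split: "C = C' + R" "conf_size G C' = m" by (meson Suc_leD)
    then have "conf_size G C = m + conf_size G R" by simp
    then have "0 < conf_size G R" using Suc.prems by simp
    then obtain v R' where "v \<in> verts G" "R = pebbles 1 v + R'" by (rule conf_remove_pebbleE)
    then have "C = (C' + pebbles 1 v) + R'" "conf_size G (C' + pebbles 1 v) = Suc m"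
      using split by (simp_all add: add.assoc)
    then show ?case by (intro exI conjI)
  qed
  then show thesis using that by blast
qed

lemma support_size_eq_sum: "support_size G D = (\<Sum>v\<in>verts G. if 0 < D v then 1 else 0)"
  by (simp add: support_size_def sum.If_cases Int_def)

lemma support_size_le_conf_size: "support_size G D \<le> conf_size G D"
  unfolding support_size_eq_sum conf_size_def by (intro sum_mono) auto

lemma conf_size_eq_support_size: "\<forall>v\<in>verts G. D v \<le> 1 \<Longrightarrow> conf_size G D = support_size G D"
  unfolding support_size_eq_sum conf_size_def by (intro sum.cong) force+

lemma support_size_add_pebble: "support_size G (pebbles 1 v + D) \<le> Suc (support_size G D)"
proof -
  have "{x \<in> verts G. 0 < (pebbles 1 v + D) x} \<subseteq> insert v {x \<in> verts G. 0 < D x}"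
    by (auto simp: pebbles_def)
  then have "support_size G (pebbles 1 v + D) \<le> card (insert v {x \<in> verts G. 0 < D x})"
    unfolding support_size_def by (intro card_mono) auto
  also have "\<dots> \<le> Suc (support_size G D)"
    unfolding support_size_def by (rule card_insert_le_m1) auto
  finally show ?thesis .
qed

lemma support_size_add_pebble_occupied:
  "0 < D v \<Longrightarrow> support_size G (pebbles 1 v + D) = support_size G D"
  unfolding support_size_def by (rule arg_cong[where f = card]) (auto simp: pebbles_def)

end

context loopfree_digraph
begin

lemma pebbling_step_iff:
  "pebbling_step G C C' \<longleftrightarrow>
     (\<exists>u w R. u \<rightarrow> w \<and> C = pebbles 2 u + R \<and> C' = pebbles 1 w + R)"
proof
  assume "pebbling_step G C C'"
  then obtain u w where move: "u \<rightarrow> w" "2 \<le> C u" "C' = C(u := C u - 2, w := C w + 1)"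
    by (auto simp: pebbling_step_def)
  let ?R = "C(u := C u - 2)"
  have "C = pebbles 2 u + ?R" "C' = pebbles 1 w + ?R"
    using move adj_not_same by (auto simp: pebbles_def fun_eq_iff)
  then show "\<exists>u w R. u \<rightarrow> w \<and> C = pebbles 2 u + R \<and> C' = pebbles 1 w + R" using move(1) by blast
next
  assume "\<exists>u w R. u \<rightarrow> w \<and> C = pebbles 2 u + R \<and> C' = pebbles 1 w + R"
  then obtain u w R where move: "u \<rightarrow> w" and confs: "C = pebbles 2 u + R" "C' = pebbles 1 w + R"
    by blast
  have "C' = C(u := C u - 2, w := C w + 1)"
    using move adj_not_same unfolding confs by (auto simp: pebbles_def)
  moreover have "2 \<le> C u" by (simp add: confs)
  ultimately show "pebbling_step G C C'" using move by (auto simp: pebbling_step_def)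
qed

lemma pebbling_step_merge: "u \<rightarrow> w \<Longrightarrow> pebbling_step G (pebbles 1 u + pebbles 1 u) (pebbles 1 w)"
  unfolding pebbling_step_iff pebbles_add[symmetric] by (metis add_0_right one_add_one)

lemma pebbling_step_add: "pebbling_step G C C' \<Longrightarrow> pebbling_step G (C + R) (C' + R)"
  unfolding pebbling_step_iff by (metis add.assoc)

lemma pebbling_relpowp_add: "(pebbling_step G ^^ n) C C' \<Longrightarrow> (pebbling_step G ^^ n) (C + R) (C' + R)"
proof (induction n arbitrary: C')
  case (Suc n)
  then obtain E where "(pebbling_step G ^^ n) C E" "pebbling_step G E C'" by auto
  then show ?case using Suc.IH pebbling_step_add by (blast intro: relpowp_Suc_I)
qed simp

abbreviation pebbles_to :: "('a \<Rightarrow> nat) \<Rightarrow> ('a \<Rightarrow> nat) \<Rightarrow> bool" (infix "\<leadsto>" 50) where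
  "C \<leadsto> C' \<equiv> (pebbling_step G)\<^sup>*\<^sup>* C C'"

lemma pebbles_to_add:
  assumes "C \<leadsto> C'" "R \<leadsto> R'"
  shows "C + R \<leadsto> C' + R'"
proof -
  have frame: "E + S \<leadsto> E' + S" if "E \<leadsto> E'" for E E' S
    using that by (metis pebbling_relpowp_add relpowp_imp_rtranclp rtranclp_imp_relpowp)
  have "C + R \<leadsto> C' + R" using frame[OF assms(1)] .
  also have "C' + R \<leadsto> C' + R'" using frame[OF assms(2), of C'] by (simp add: add.commute)
  finally show ?thesis .
qed

lemma pebbles_to_merge:
  assumes "C \<leadsto> pebbles 1 u" "C' \<leadsto> pebbles 1 u" "u \<rightarrow> w"
  shows "C + C' \<leadsto> pebbles 1 w"
  using pebbles_to_add[OF assms(1,2)] pebbling_step_merge[OF assms(3)]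
  by (blast intro: rtranclp.rtrancl_into_rtrancl)

lemma target_solvable_0: "target_solvable G 0 C"
  by (auto simp: target_solvable_def)

lemma target_solvable_add:
  assumes "target_solvable G D C" "target_solvable G D' C'"
  shows "target_solvable G (D + D') (C + C')"
proof -
  obtain E where reached: "C \<leadsto> E" "\<forall>v\<in>verts G. D v \<le> E v"
    using assms(1) by (auto simp: target_solvable_def)
  obtain E' where reached': "C' \<leadsto> E'" "\<forall>v\<in>verts G. D' v \<le> E' v"
    using assms(2) by (auto simp: target_solvable_def)
  have "\<forall>v\<in>verts G. (D + D') v \<le> (E + E') v" using reached(2) reached'(2) by (simp add: add_mono)
  then show ?thesis
    using pebbles_to_add[OF reached(1) reached'(1)] by (auto simp: target_solvable_def)
qed

lemma target_solvable_add_pebble: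
  assumes "c \<leadsto> pebbles 1 v" "target_solvable G D C"
  shows "target_solvable G (pebbles 1 v + D) (c + C)"
proof (rule target_solvable_add[OF _ assms(2)])
  show "target_solvable G (pebbles 1 v) c" using assms(1) by (auto simp: target_solvable_def)
qed

lemma fold_solvable_iff_target_solvable:
  "r \<in> verts G \<Longrightarrow> fold_solvable G t r C \<longleftrightarrow> target_solvable G (pebbles t r) C"
  by (auto simp: fold_solvable_def target_solvable_def pebbles_def)

end

lemma (in digraph) conf_size_pebbling_relpowp:
  "(pebbling_step G ^^ n) C C' \<Longrightarrow> conf_size G C = conf_size G C' + n"
proof (induction n arbitrary: C')
  case (Suc n)
  then obtain E where steps: "(pebbling_step G ^^ n) C E" "pebbling_step G E C'" by auto
  then have "conf_size G E = Suc (conf_size G C')"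
    using adj_in_verts by (auto simp: pebbling_step_iff)
  then show ?case using Suc.IH[OF steps(1)] by simp
qed simp

lemma (in digraph) solves_with_cost_at_most_add:
  assumes vert: "v \<in> verts G" and collected: "c \<leadsto> pebbles 1 v"
  shows "solves_with_cost_at_most G (c + R) v (conf_size G c)"
proof -
  obtain n where steps: "(pebbling_step G ^^ n) c (pebbles 1 v)"
    using rtranclp_imp_relpowp[OF collected] by blast
  then have "conf_size G c = n + 1" using conf_size_pebbling_relpowp[OF steps] vert by simp
  moreover have "1 \<le> (pebbles 1 v + R) v" by simp
  ultimately show ?thesis
    using pebbling_relpowp_add[OF steps, of R] unfolding solves_with_cost_at_most_def by fastforce
qed

section \<open>Collecting a pebble cheaply\<close>

context tree_graph
begin

definition cheap_piece :: "'a \<Rightarrow> ('a \<Rightarrow> nat) \<Rightarrow> 'a \<Rightarrow> bool" where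
  "cheap_piece r c u \<longleftrightarrow> u \<in> verts G \<and> c \<leadsto> pebbles 1 u \<and> conf_size G c \<le> 2 ^ height r u"

lemma cheap_piece_pebble: "v \<in> verts G \<Longrightarrow> cheap_piece r (pebbles 1 v) v"
  by (simp add: cheap_piece_def)

lemma cheap_piece_merge:
  assumes root: "r \<in> verts G" and child: "u \<in> children r p"
    and "cheap_piece r c u" "cheap_piece r c' u"
  shows "cheap_piece r (c + c') p"
proof -
  have "conf_size G (c + c') \<le> 2 ^ Suc (height r u)"
    using assms(3,4) by (simp add: cheap_piece_def)
  also have "\<dots> \<le> 2 ^ height r p"
    using height_child_less[OF root child] by (intro power_increasing) auto
  finally show ?thesis
    using pebbles_to_merge[OF _ _ children_adj(2)[OF child]] children_adj(3)[OF child] assms(3,4)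
    by (simp add: cheap_piece_def)
qed

lemma cheap_piece_on_leaf:
  assumes "cheap_piece r c u" "height r u = 0"
  shows "0 < c u"
proof -
  have piece: "u \<in> verts G" "c \<leadsto> pebbles 1 u" "conf_size G c \<le> 1"
    using assms by (simp_all add: cheap_piece_def)
  obtain n where steps: "(pebbling_step G ^^ n) c (pebbles 1 u)"
    using rtranclp_imp_relpowp[OF piece(2)] by (elim exE)
  then have "n = 0" using conf_size_pebbling_relpowp[OF steps] piece(1,3) by simp
  then show ?thesis using steps by simp
qed

text \<open>Off \<open>verts G\<close> the pieces vanish while \<open>C\<close> is arbitrary; hence \<open>\<le>\<close> and equal sizes.\<close>

definition cheap_partition :: "'a \<Rightarrow> ('a \<Rightarrow> nat) \<Rightarrow> (('a \<Rightarrow> nat) \<times> 'a) multiset \<Rightarrow> bool" where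
  "cheap_partition r C M \<longleftrightarrow>
     (\<forall>(c, u)\<in>#M. cheap_piece r c u) \<and>
     (\<Sum>p\<in>#M. fst p) \<le> C \<and> conf_size G (\<Sum>p\<in>#M. fst p) = conf_size G C"

lemma cheap_partition_exists: "\<exists>M. cheap_partition r C M"
proof (induction "conf_size G C" arbitrary: C)
  case 0
  then have "cheap_partition r C {#}" by (simp add: cheap_partition_def le_fun_def)
  then show ?case by blast
next
  case (Suc n)
  then have "0 < conf_size G C" by simp
  then obtain v R where vert: "v \<in> verts G" and split: "C = pebbles 1 v + R"
    by (rule conf_remove_pebbleE)
  then obtain M where "cheap_partition r R M" using Suc by force
  then have "cheap_partition r C (add_mset (pebbles 1 v, v) M)"
    using cheap_piece_pebble[OF vert] vert
    unfolding split by (auto simp: cheap_partition_def le_fun_def)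
  then show ?case by blast
qed

lemma cheap_partition_merge:
  assumes root: "r \<in> verts G" and not_root: "u \<noteq> r"
    and partition: "cheap_partition r C (add_mset (c, u) (add_mset (c', u) M))"
  obtains p where "cheap_partition r C (add_mset (c + c', p) M)"
proof -
  have pieces: "cheap_piece r c u" "cheap_piece r c' u"
    using partition by (auto simp: cheap_partition_def)
  then obtain p where parent: "u \<in> children r p"
    using parentE[OF root _ not_root] by (auto simp: cheap_piece_def)
  have "cheap_partition r C (add_mset (c + c', p) M)"
    using partition cheap_piece_merge[OF root parent pieces]
    by (auto simp: cheap_partition_def add.assoc)
  then show thesis using that by blast
qed

lemma reduced_cheap_partitionE:
  assumes root: "r \<in> verts G"
  obtains M where "cheap_partition r C M" "\<forall>u. u \<noteq> r \<longrightarrow> count (image_mset snd M) u \<le> 1"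
proof -
  obtain M where partition: "cheap_partition r C M"
    and minimal: "\<And>N. cheap_partition r C N \<Longrightarrow> size M \<le> size N"
    using ex_has_least_nat[of "cheap_partition r C" _ size] cheap_partition_exists by metis
  have "count (image_mset snd M) u \<le> 1" if not_root: "u \<noteq> r" for u
  proof (rule ccontr)
    assume "\<not> count (image_mset snd M) u \<le> 1"
    then have "add_mset u {#u#} \<subseteq># image_mset snd M" by (intro mset_subset_eqI) auto
    then obtain A where "image_mset snd M = add_mset u (add_mset u A)"
      by (auto simp: subset_mset.le_iff_add)
    then obtain K p where first: "M = add_mset p K" "snd p = u" "image_mset snd K = add_mset u A"
      using msed_map_invR by metis
    then obtain N q where "K = add_mset q N" "snd q = u" using msed_map_invR by metis
    then obtain c c' where split: "M = add_mset (c, u) (add_mset (c', u) N)"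
      using first by (cases p; cases q) auto
    then obtain p where "cheap_partition r C (add_mset (c + c', p) N)"
      using cheap_partition_merge[OF root not_root] partition by blast
    then show False using minimal[of "add_mset (c + c', p) N"] split by simp
  qed
  then show thesis using that partition by blast
qed

definition empty_leaves :: "'a \<Rightarrow> ('a \<Rightarrow> nat) \<Rightarrow> 'a set" where
  "empty_leaves r C = {u \<in> verts G - {r}. height r u = 0 \<and> C u = 0}"

lemma finite_empty_leaves [simp]: "finite (empty_leaves r C)"
  by (simp add: empty_leaves_def)

lemma weight_eq_sum_plus_card_empty_leaves:
  "weight r = (\<Sum>u\<in>verts G - {r} - empty_leaves r C. 2 ^ height r u) + card (empty_leaves r C)"
proof -
  have "weight r = (\<Sum>u\<in>verts G - {r} - empty_leaves r C. 2 ^ height r u)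
      + (\<Sum>u\<in>empty_leaves r C. 2 ^ height r u)"
    unfolding weight_def by (intro sum.subset_diff) (auto simp: empty_leaves_def)
  also have "(\<Sum>u\<in>empty_leaves r C. (2::nat) ^ height r u) = card (empty_leaves r C)"
    by (simp add: empty_leaves_def)
  finally show ?thesis .
qed

lemma cheap_partition_le:
  assumes "cheap_partition r C M" "(c, u) \<in># M"
  shows "c \<le> C"
proof -
  have "c \<le> (\<Sum>p\<in>#M. fst p)"
    using multi_member_split[OF assms(2)] by (auto simp: le_fun_def)
  also have "\<dots> \<le> C" using assms(1) by (simp add: cheap_partition_def)
  finally show ?thesis .
qed

lemma cheap_partition_size_le_weight:
  assumes partition: "cheap_partition r C M"
    and simple: "\<forall>u. u \<noteq> r \<longrightarrow> count (image_mset snd M) u \<le> 1"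
    and no_root: "r \<notin># image_mset snd M"
  shows "conf_size G C + card (empty_leaves r C) \<le> weight r"
proof -
  let ?U = "verts G - {r} - empty_leaves r C"
  have piece: "cheap_piece r c u" if "(c, u) \<in># M" for c u
    using partition that by (auto simp: cheap_partition_def)
  have "u \<in> ?U" if "u \<in># image_mset snd M" for u
  proof -
    obtain c where member: "(c, u) \<in># M" using \<open>u \<in># image_mset snd M\<close> by auto
    have "u \<notin> empty_leaves r C"
    proof
      assume "u \<in> empty_leaves r C"
      then have "height r u = 0" "C u = 0" by (auto simp: empty_leaves_def)
      then show False
        using cheap_piece_on_leaf[OF piece[OF member]]
          le_funD[OF cheap_partition_le[OF partition member], of u] by simp
    qed
    then show ?thesis using piece[OF member] no_root that by (auto simp: cheap_piece_def)
  qed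
  then have "image_mset snd M \<subseteq># mset_set ?U"
    using simple no_root by (intro mset_subset_eqI)
      (metis count_eq_zero_iff count_mset_set' finite_Diff finite_verts le0)
  then obtain A where "mset_set ?U = image_mset snd M + A" by (auto simp: subset_mset.le_iff_add)
  then have "(\<Sum>u\<in>#image_mset snd M. 2 ^ height r u) \<le> (\<Sum>u\<in>?U. (2::nat) ^ height r u)"
    by (simp add: sum_unfold_sum_mset)
  moreover have "conf_size G C = (\<Sum>p\<in>#M. conf_size G (fst p))"
    using partition by (simp add: cheap_partition_def conf_size_sum_mset multiset.map_comp comp_def)
  moreover have "\<dots> \<le> (\<Sum>p\<in>#M. 2 ^ height r (snd p))"
    using piece by (intro sum_mset_mono) (auto simp: cheap_piece_def)
  ultimately show ?thesis
    using weight_eq_sum_plus_card_empty_leaves[of r C] by (simp add: multiset.map_comp comp_def)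
qed

lemma cheap_pieceE:
  assumes root: "r \<in> verts G" and size: "weight r < conf_size G C + card (empty_leaves r C)"
  obtains c R where "C = c + R" "c \<leadsto> pebbles 1 r" "conf_size G c \<le> 2 ^ ecc G r"
proof -
  obtain M where partition: "cheap_partition r C M" "\<forall>u. u \<noteq> r \<longrightarrow> count (image_mset snd M) u \<le> 1"
    using reduced_cheap_partitionE[OF root, of C] .
  then obtain c where member: "(c, r) \<in># M"
    using cheap_partition_size_le_weight[OF partition] size by fastforce
  then have "cheap_piece r c r" using partition(1) by (auto simp: cheap_partition_def)
  then show thesis
    using that le_imp_eq_add_diff[OF cheap_partition_le[OF partition(1) member]]
      height_root[OF root] by (simp add: cheap_piece_def)
qed

lemma fold_solvable_large:
  assumes root: "r \<in> verts G"
  shows "weight r + t * 2 ^ ecc G r < conf_size G C + 2 ^ ecc G r \<Longrightarrow> fold_solvable G t r C"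
  unfolding fold_solvable_iff_target_solvable[OF root]
proof (induction t arbitrary: C)
  case 0
  show ?case unfolding pebbles_0 by (rule target_solvable_0)
next
  case (Suc t)
  then obtain c R where split: "C = c + R"
    and piece: "c \<leadsto> pebbles 1 r" "conf_size G c \<le> 2 ^ ecc G r"
    using cheap_pieceE[OF root, of C] by auto
  have "conf_size G C = conf_size G c + conf_size G R" using split by simp
  then have "target_solvable G (pebbles t r) R" using Suc.IH[of R] Suc.prems piece(2) by simp
  then show ?case
    unfolding split plus_1_eq_Suc[symmetric] pebbles_add
    by (rule target_solvable_add_pebble[OF piece(1)])
qed

section \<open>Unsolvable configurations\<close>

definition inflow :: "'a \<Rightarrow> ('a \<Rightarrow> nat) \<Rightarrow> 'a \<Rightarrow> nat" where
  "inflow r f u = (\<Sum>x\<in>children r u. f x div 2)"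

lemma inflow_fun_upd_parent:
  assumes "x \<in> children r u"
  shows "inflow r (f(x := a)) u + f x div 2 = inflow r f u + a div 2"
proof -
  let ?rest = "\<Sum>y\<in>children r u - {x}. f y div 2"
  have "inflow r f u = f x div 2 + ?rest" "inflow r (f(x := a)) u = a div 2 + ?rest"
    using assms by (simp_all add: inflow_def sum.remove)
  then show ?thesis by simp
qed

lemma inflow_fun_upd_other:
  assumes "r \<in> verts G" "x \<in> children r u" "z \<noteq> u"
  shows "inflow r (f(x := a)) z = inflow r f z"
  unfolding inflow_def using parent_unique[OF assms(1,2)] assms(3) by (intro sum.cong) auto

text \<open>
  \<open>f u\<close> bounds the number of pebbles that the subtree of \<open>u\<close> can bring to \<open>u\<close>. The existence of such
  an \<open>f\<close> with value \<open>k\<close> at the root is invariant under pebbling steps, and under replacing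
  pebbles by twice as many on a child.
\<close>

definition capacity :: "'a \<Rightarrow> ('a \<Rightarrow> nat) \<Rightarrow> ('a \<Rightarrow> nat) \<Rightarrow> bool" where
  "capacity r f C \<longleftrightarrow> (\<forall>u\<in>verts G. C u + inflow r f u \<le> f u)"

definition capped :: "'a \<Rightarrow> nat \<Rightarrow> ('a \<Rightarrow> nat) \<Rightarrow> bool" where
  "capped r k C \<longleftrightarrow> (\<exists>f. f r = k \<and> capacity r f C)"

lemma capped_root_le: "r \<in> verts G \<Longrightarrow> capped r k C \<Longrightarrow> C r \<le> k"
  by (fastforce simp: capped_def capacity_def)

lemma capped_update_child:
  assumes root: "r \<in> verts G" and is_child: "x \<in> children r u" and cap: "capacity r f C"
    and other: "\<And>z. z \<noteq> u \<Longrightarrow> z \<noteq> x \<Longrightarrow> C' z \<le> C z"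
    and child: "C' x + f x \<le> C x + a"
    and parent: "C' u + a div 2 \<le> C u + f x div 2"
  shows "capped r (f r) C'"
proof -
  let ?f = "f(x := a)"
  have "x \<noteq> u" using is_child self_not_child by blast
  have "C' z + inflow r ?f z \<le> ?f z" if vert: "z \<in> verts G" for z
  proof (cases "z = u")
    case True
    have "C u + inflow r f u \<le> f u" using cap vert True by (simp add: capacity_def)
    then show ?thesis
      using True inflow_fun_upd_parent[OF is_child, of f a] parent \<open>x \<noteq> u\<close> by simp
  next
    case False
    have "C z + inflow r f z \<le> f z" using cap vert by (simp add: capacity_def)
    then show ?thesis
      using inflow_fun_upd_other[OF root is_child False] child other[OF False]
      by (cases "z = x") auto
  qed
  moreover have "?f r = f r" using root_not_child[OF root] is_child by auto
  ultimately show ?thesis unfolding capped_def capacity_def by blast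
qed

lemma capped_pebbling_step:
  assumes root: "r \<in> verts G" and capped: "capped r k C" and step: "pebbling_step G C C'"
  shows "capped r k C'"
proof -
  obtain f where cap: "f r = k" "capacity r f C" using capped by (auto simp: capped_def)
  obtain u w R where adj: "u \<rightarrow> w" and move: "C = pebbles 2 u + R" "C' = pebbles 1 w + R"
    using step by (auto simp: pebbling_step_iff)
  have "u \<noteq> w" using adj adj_not_same by blast
  from root adj have "capped r (f r) C'"
  proof (cases rule: adj_children_cases)
    case child
    show ?thesis
      by (rule capped_update_child[OF root child cap(2), where a = "f w + 1"])
        (use \<open>u \<noteq> w\<close> in \<open>auto simp: move pebbles_def\<close>)
  next
    case parent
    have "C u \<le> f u" using cap(2) children_adj(4)[OF parent] by (fastforce simp: capacity_def)
    then have "2 \<le> f u" by (simp add: move)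
    then show ?thesis
      by (intro capped_update_child[OF root parent cap(2), where a = "f u - 2"])
        (use \<open>u \<noteq> w\<close> in \<open>auto simp: move pebbles_def\<close>)
  qed
  then show ?thesis by (simp add: cap(1))
qed

lemma capped_pebbles_to:
  assumes "r \<in> verts G" "C \<leadsto> C'" "capped r k C"
  shows "capped r k C'"
  using assms(2,3)
  by (induction rule: rtranclp_induct) (blast intro: capped_pebbling_step[OF assms(1)])+

lemma capped_push_child:
  assumes root: "r \<in> verts G" and child: "x \<in> children r u"
    and capped: "capped r k (R + pebbles m u)"
  shows "capped r k (R + pebbles (2 * m) x)"
proof -
  obtain f where cap: "f r = k" "capacity r f (R + pebbles m u)"
    using capped by (auto simp: capped_def)
  have "x \<noteq> u" using child self_not_child by blast
  then have "capped r (f r) (R + pebbles (2 * m) x)"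
    by (intro capped_update_child[OF root child cap(2), where a = "f x + 2 * m"])
      (auto simp: pebbles_def)
  then show ?thesis by (simp add: cap(1))
qed

lemma capped_push_descendant:
  assumes root: "r \<in> verts G" and vert: "u \<in> verts G" and descendant: "l \<in> subtree r u"
    and capped: "capped r k (R + pebbles m u)"
  shows "capped r k (R + pebbles (2 ^ gdist u l * m) l)"
proof -
  have "l \<in> verts G" using descendant by (simp add: subtree_def)
  with vert have "l \<in> subtree r u \<longrightarrow> ?thesis"
  proof (induction rule: rooted_induct)
    case root
    show ?case using capped vert by (simp del: plus_fun_apply)
  next
    case (child y x)
    show ?case
    proof
      assume below: "x \<in> subtree r u"
      have verts: "x \<in> verts G" "y \<in> verts G" using children_adj[OF child.hyps] by auto
      have "gdist r y = gdist r u + gdist u y"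
        using graph_dist_triangle[of r u y] graph_dist_Suc_adj[of r y x]
          children_adj(1)[OF child.hyps] gdist_child[OF child.hyps] below root vert verts
        by (simp add: subtree_def)
      then have "y \<in> subtree r u" "x \<in> children r y"
        using below gdist_child[OF child.hyps] children_adj(1)[OF child.hyps] verts
        by (simp_all add: subtree_def children_def)
      then show "capped r k (R + pebbles (2 ^ gdist u x * m) x)"
        using capped_push_child[OF root _ child.IH[rule_format]] gdist_child[OF child.hyps]
        by (simp add: mult.assoc)
    qed
  qed
  then show ?thesis using descendant by blast
qed

lemma capped_push_all:
  assumes root: "r \<in> verts G" and "S \<subseteq> verts G" and "\<And>u. u \<in> S \<Longrightarrow> l u \<in> subtree r u"
    and "capped r k (R + (\<Sum>u\<in>S. pebbles (m u) u))"
  shows "capped r k (R + (\<Sum>u\<in>S. pebbles (2 ^ gdist u (l u) * m u) (l u)))"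
  using finite_subset[OF assms(2) finite_verts] assms(2-)
proof (induction S arbitrary: R rule: finite_induct)
  case empty
  then show ?case by simp
next
  case (insert u S)
  let ?p = "pebbles (2 ^ gdist u (l u) * m u) (l u)" and ?S = "\<Sum>v\<in>S. pebbles (m v) v"
  have "capped r k ((R + ?S) + pebbles (m u) u)"
    using insert.prems(3) insert.hyps by (simp add: ac_simps del: plus_fun_apply)
  then have "capped r k ((R + ?S) + ?p)"
    using insert.prems(1,2) by (intro capped_push_descendant[OF root]) auto
  then have "capped r k ((R + ?p) + ?S)" by (simp add: ac_simps)
  then have "capped r k ((R + ?p) + (\<Sum>v\<in>S. pebbles (2 ^ gdist v (l v) * m v) (l v)))"
    using insert.prems(1,2) by (intro insert.IH) (auto simp del: plus_fun_apply)
  then show ?case using insert.hyps by (simp add: ac_simps del: plus_fun_apply)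
qed

lemma sum_pebbles_apply:
  "finite S \<Longrightarrow> (\<Sum>u\<in>S. pebbles (m u) u) x = (if x \<in> S then m x else 0)"
  by (induction S rule: finite_induct) (auto simp: pebbles_def)

lemma unsolvable_confE:
  assumes root: "r \<in> verts G"
  obtains C where "conf_size G C = weight r + k * 2 ^ ecc G r" "\<forall>C'. C \<leadsto> C' \<longrightarrow> C' r \<le> k"
proof -
  define m where "m = (\<lambda>u. if u = r then k else 1)"
  have "\<forall>u\<in>verts G. \<exists>z\<in>subtree r u. gdist u z = height r u" using height_attainedE by metis
  then obtain l where deepest: "\<And>u. u \<in> verts G \<Longrightarrow> l u \<in> subtree r u \<and> gdist u (l u) = height r u"
    by metis
  define C where "C = (\<Sum>u\<in>verts G. pebbles (2 ^ gdist u (l u) * m u) (l u))"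
  have "inflow r m u = 0" for u
    using root_not_child[OF root, of u]
    unfolding inflow_def by (intro sum.neutral) (auto simp: m_def)
  then have "capacity r m (\<Sum>u\<in>verts G. pebbles (m u) u)"
    by (simp add: capacity_def sum_pebbles_apply)
  moreover have "m r = k" by (simp add: m_def)
  ultimately have "capped r k (0 + (\<Sum>u\<in>verts G. pebbles (m u) u))"
    unfolding capped_def add_0 by blast
  then have "capped r k (0 + C)"
    unfolding C_def using deepest by (intro capped_push_all[OF root]) auto
  then have "C' r \<le> k" if "C \<leadsto> C'" for C'
    using capped_root_le[OF root capped_pebbles_to[OF root that]] by (simp only: add_0)
  moreover have "conf_size G C = weight r + k * 2 ^ ecc G r"
  proof -
    have "l u \<in> verts G" if "u \<in> verts G" for u using deepest[OF that] by (simp add: subtree_def)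
    then have "conf_size G C = (\<Sum>u\<in>verts G. 2 ^ height r u * m u)"
      using deepest by (simp add: C_def)
    also have "\<dots> = 2 ^ ecc G r * k + (\<Sum>u\<in>verts G - {r}. 2 ^ height r u * m u)"
      using root by (simp add: sum.remove[of "verts G" r] height_root m_def)
    also have "(\<Sum>u\<in>verts G - {r}. 2 ^ height r u * m u) = weight r"
      unfolding weight_def by (intro sum.cong) (auto simp: m_def)
    finally show ?thesis by simp
  qed
  ultimately show thesis using that by blast
qed

theorem rooted_pebbling_number_eq:
  assumes root: "r \<in> verts G"
  shows "rooted_pebbling_number G (Suc k) r = weight r + k * 2 ^ ecc G r + 1"
  unfolding rooted_pebbling_number_def
proof (rule Least_equality)
  show "\<forall>C. conf_size G C = weight r + k * 2 ^ ecc G r + 1 \<longrightarrow> fold_solvable G (Suc k) r C"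
    using fold_solvable_large[OF root] by simp
  fix n assume solvable: "\<forall>C. conf_size G C = n \<longrightarrow> fold_solvable G (Suc k) r C"
  obtain C where unsolvable: "conf_size G C = weight r + k * 2 ^ ecc G r" "\<forall>C'. C \<leadsto> C' \<longrightarrow> C' r \<le> k"
    using unsolvable_confE[OF root, of k] .
  show "weight r + k * 2 ^ ecc G r + 1 \<le> n"
  proof (rule ccontr)
    assume "\<not> ?thesis"
    then obtain E R where "C = E + R" "conf_size G E = n"
      using conf_splitE[of n C] unsolvable(1) by auto
    then have "target_solvable G (pebbles (Suc k) r + 0) C"
      using solvable target_solvable_add[OF _ target_solvable_0]
        fold_solvable_iff_target_solvable[OF root] by blast
    then have "fold_solvable G (Suc k) r C"
      by (simp only: add_0_right fold_solvable_iff_target_solvable[OF root])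
    then show False using unsolvable(2) by (fastforce simp: fold_solvable_def)
  qed
qed

theorem fold_pebbling_number_eq:
  "fold_pebbling_number G (Suc k) = max_weight + k * 2 ^ graph_diameter G + 1"
  unfolding fold_pebbling_number_def
proof (rule Max_eqI)
  let ?\<pi> = "rooted_pebbling_number G (Suc k)"
  show "finite (?\<pi> ` verts G)" by simp
  show "n \<le> max_weight + k * 2 ^ graph_diameter G + 1" if attained: "n \<in> ?\<pi> ` verts G" for n
  proof -
    obtain r where root: "r \<in> verts G" "n = weight r + k * 2 ^ ecc G r + 1"
      using attained by (auto simp: rooted_pebbling_number_eq)
    show ?thesis
      unfolding root(2)
      by (intro add_mono mult_le_mono weight_le_max_weight[OF root(1)]
        power_ecc_le_power_diameter[OF root(1)] order_refl)
  qed
  obtain y where peripheral: "y \<in> periphery" "weight y = max_weight" using max_weight_peripheralE .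
  then have "?\<pi> y = max_weight + k * 2 ^ graph_diameter G + 1"
    by (simp add: rooted_pebbling_number_eq periphery_def)
  then show "max_weight + k * 2 ^ graph_diameter G + 1 \<in> ?\<pi> ` verts G"
    using peripheral(1) periphery_subset by force
qed

section \<open>Serving the targets\<close>

lemma card_empty_periphery_le:
  assumes "v \<in> verts G"
  shows "card {u \<in> periphery. C u = 0} \<le> Suc (card (empty_leaves v C))"
proof -
  have "{u \<in> periphery. C u = 0} \<subseteq> insert v (empty_leaves v C)"
    using height_peripheral[OF assms] periphery_subset by (auto simp: empty_leaves_def)
  then have "card {u \<in> periphery. C u = 0} \<le> card (insert v (empty_leaves v C))"
    by (intro card_mono) auto
  also have "\<dots> \<le> Suc (card (empty_leaves v C))" by (rule card_insert_le_m1) auto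
  finally show ?thesis .
qed

lemma target_solvable_of_empty_periphery:
  assumes "max_weight + 2 + conf_size G D * 2 ^ graph_diameter G
    \<le> conf_size G C + card {u \<in> periphery. C u = 0} + 2 ^ graph_diameter G"
  shows "target_solvable G D C"
  using assms
proof (induction "conf_size G D" arbitrary: C D)
  case 0
  then show ?case by (auto simp: target_solvable_def conf_size_def)
next
  case (Suc t)
  have "0 < conf_size G D" using Suc.hyps(2) by simp
  then obtain v D' where vert: "v \<in> verts G" and D_split: "D = pebbles 1 v + D'"
    by (rule conf_remove_pebbleE)
  have size_D: "conf_size G D = Suc (conf_size G D')" using vert D_split by simp
  then have "weight v < conf_size G C + card (empty_leaves v C)"
    using Suc.prems weight_le_max_weight[OF vert] card_empty_periphery_le[OF vert, of C] by simp
  then obtain c R where C_split: "C = c + R"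
    and piece: "c \<leadsto> pebbles 1 v" "conf_size G c \<le> 2 ^ ecc G v"
    using cheap_pieceE[OF vert] by blast
  have "conf_size G C = conf_size G c + conf_size G R" using C_split by simp
  moreover have "conf_size G c \<le> 2 ^ graph_diameter G"
    using piece(2) power_ecc_le_power_diameter[OF vert] by (rule le_trans)
  moreover have "card {u \<in> periphery. C u = 0} \<le> card {u \<in> periphery. R u = 0}"
    unfolding C_split by (intro card_mono) auto
  ultimately have "target_solvable G D' R"
    using Suc.prems Suc.hyps(2) size_D by (intro Suc.hyps(1)) auto
  then show ?case unfolding C_split D_split by (rule target_solvable_add_pebble[OF piece(1)])
qed

text \<open>\<open>|C| \<ge> \<pi>\<^sub>t(T) - s(D) + 1\<close> for \<open>t = |D|\<close>, without subtraction.\<close>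

definition ample :: "('a \<Rightarrow> nat) \<Rightarrow> ('a \<Rightarrow> nat) \<Rightarrow> bool" where
  "ample D C \<longleftrightarrow> max_weight + 2 + conf_size G D * 2 ^ graph_diameter G
     \<le> conf_size G C + support_size G D + 2 ^ graph_diameter G"

lemma ample_imp_max_weight_less:
  assumes "0 < conf_size G D" "ample D C"
  shows "max_weight < conf_size G C"
proof -
  let ?N = "2 ^ graph_diameter G :: nat"
  have "conf_size G D + ?N \<le> conf_size G D * ?N + 1"
    using assms(1) by (cases "conf_size G D") (auto simp: add_mono)
  then show ?thesis
    using assms(2) support_size_le_conf_size[of D] unfolding ample_def by linarith
qed

lemma economical_pieceE:
  assumes vert: "v \<in> verts G" and size: "weight v < conf_size G C" and D_pos: "0 < conf_size G D"
    and cheap: "0 < D v \<or> 0 < C v \<or> v \<notin> periphery"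
  obtains c R where "C = c + R" "c \<leadsto> pebbles 1 v"
    "conf_size G c + support_size G (pebbles 1 v + D) \<le> 2 ^ graph_diameter G + support_size G D"
proof -
  let ?d = "graph_diameter G"
  obtain c R where split: "C = c + R" and piece: "c \<leadsto> pebbles 1 v" "conf_size G c \<le> 2 ^ ecc G v"
    using cheap_pieceE[OF vert, of C] size by auto
  have supp: "support_size G (pebbles 1 v + D) \<le> Suc (support_size G D)"
    by (rule support_size_add_pebble)
  consider (still_wanted) "0 < D v" | (inner) "v \<notin> periphery" | (occupied) "D v = 0" "0 < C v"
    using cheap by auto
  then show thesis
  proof cases
    case still_wanted
    have "conf_size G c \<le> 2 ^ ?d"
      using piece(2) power_ecc_le_power_diameter[OF vert] by (rule le_trans)
    then show thesis
      using that[OF split piece(1)] support_size_add_pebble_occupied[of D v, OF still_wanted]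
      by simp
  next
    case inner
    then have "ecc G v < ?d" using vert ecc_le_diameter[OF vert] by (simp add: periphery_def)
    then have "(2::nat) ^ ecc G v < 2 ^ ?d" by (intro power_strict_increasing) auto
    with piece(2) have "conf_size G c < 2 ^ ?d" by (rule le_less_trans)
    then show thesis using that[OF split piece(1)] supp by simp
  next
    case occupied
    obtain w D' where other: "w \<in> verts G" and "D = pebbles 1 w + D'"
      using conf_remove_pebbleE[OF D_pos] .
    then have "w \<noteq> v" using occupied by auto
    then have "0 < gdist v w" using graph_dist_eq_0_iff[of v w] vert other by simp
    then have "0 < ?d" using graph_dist_le_diameter[OF vert other] by simp
    then have "(2::nat) ^ 1 \<le> 2 ^ ?d" by (intro power_increasing) auto
    moreover have "C = pebbles 1 v + (\<lambda>x. C x - pebbles 1 v x)"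
      using occupied by (intro le_imp_eq_add_diff) (auto simp: pebbles_def le_fun_def)
    ultimately show thesis using that[of "pebbles 1 v"] supp vert by simp
  qed
qed

lemma target_solvable_peel:
  assumes vert: "v \<in> verts G" and cheap: "0 < D v \<or> 0 < C v \<or> v \<notin> periphery"
    and ample: "ample (pebbles 1 v + D) C"
    and rest: "\<And>R. 0 < conf_size G D \<Longrightarrow> ample D R \<Longrightarrow> target_solvable G D R"
  shows "target_solvable G (pebbles 1 v + D) C"
proof -
  have size: "weight v < conf_size G C"
    using ample_imp_max_weight_less[OF _ ample] weight_le_max_weight[OF vert] vert by simp
  obtain c R where split: "C = c + R" and piece: "c \<leadsto> pebbles 1 v"
    and rest_solvable: "target_solvable G D R"
  proof (cases "conf_size G D = 0")
    case True
    then have "target_solvable G D R" for R by (auto simp: target_solvable_def conf_size_def)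
    then show thesis using that cheap_pieceE[OF vert, of C] size by (metis trans_less_add1)
  next
    case False
    then have D_pos: "0 < conf_size G D" by simp
    obtain c R where split: "C = c + R" and piece: "c \<leadsto> pebbles 1 v"
      and cost: "conf_size G c + support_size G (pebbles 1 v + D)
        \<le> 2 ^ graph_diameter G + support_size G D"
      using economical_pieceE[OF vert size D_pos cheap] .
    have "conf_size G C = conf_size G c + conf_size G R" using split by simp
    then have "ample D R" using ample cost vert by (simp add: ample_def)
    then show thesis using that split piece rest D_pos by blast
  qed
  show ?thesis unfolding split by (rule target_solvable_add_pebble[OF piece rest_solvable])
qed

lemma target_solvable_ample: "0 < conf_size G D \<Longrightarrow> ample D C \<Longrightarrow> target_solvable G D C"
proof (induction "conf_size G D" arbitrary: C D rule: less_induct)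
  case less
  show ?case
  proof (cases "\<exists>v\<in>verts G. 2 \<le> D v \<or> 0 < D v \<and> (0 < C v \<or> v \<notin> periphery)")
    case True
    then obtain v where target: "v \<in> verts G" "2 \<le> D v \<or> 0 < D v \<and> (0 < C v \<or> v \<notin> periphery)" ..
    define D' where "D' = (\<lambda>x. D x - pebbles 1 v x)"
    have D_split: "D = pebbles 1 v + D'"
      unfolding D'_def
      using target(2) by (intro le_imp_eq_add_diff) (auto simp: pebbles_def le_fun_def)
    show ?thesis
      unfolding D_split
    proof (rule target_solvable_peel[OF target(1)])
      show "0 < D' v \<or> 0 < C v \<or> v \<notin> periphery" using target(2) by (auto simp: D'_def)
      show "ample (pebbles 1 v + D') C" using less.prems(2) D_split by simp
      show "target_solvable G D' R" if "0 < conf_size G D'" "ample D' R" for R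
        using D_split target(1) that by (intro less.hyps) simp_all
    qed
  next
    case False
    then have "\<forall>v\<in>verts G. D v \<le> 1" by force
    then have "conf_size G D = support_size G D" by (rule conf_size_eq_support_size)
    moreover have "support_size G D \<le> card {u \<in> periphery. C u = 0}"
      unfolding support_size_def using False by (intro card_mono) auto
    ultimately show ?thesis
      using less.prems(2) by (intro target_solvable_of_empty_periphery) (simp add: ample_def)
  qed
qed

lemma solves_with_cost_at_most_ecc:
  assumes vert: "v \<in> verts G" and "weight v < conf_size G C"
  shows "solves_with_cost_at_most G C v (2 ^ ecc G v)"
proof -
  obtain c R where "C = c + R" "c \<leadsto> pebbles 1 v" "conf_size G c \<le> 2 ^ ecc G v"
    using cheap_pieceE[OF vert, of C] assms(2) by auto
  then show ?thesis
    using solves_with_cost_at_most_add[OF vert, of c R] unfolding solves_with_cost_at_most_def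
    by (meson le_trans)
qed

end

theorem theorem4:
  fixes T :: "('a, 'b) pre_digraph" and D :: "'a \<Rightarrow> nat" and d t :: nat
  assumes "undirected_tree T"
    and "graph_diameter T = d"
    and "conf_size T D = t"
    and "t \<ge> 1"
  shows "int (target_pebbling_number T D)
           \<le> int (fold_pebbling_number T t) - int (support_size T D) + 1
    \<and> (\<forall>C :: 'a \<Rightarrow> nat.
          int (conf_size T C) \<ge> int (fold_pebbling_number T t) - int (support_size T D) + 1
          \<longrightarrow> (\<forall>v\<in>verts T. D v > 0 \<longrightarrow> solves_with_cost_at_most T C v (2 ^ ecc T v)))"
proof -
  interpret graph T using assms(1) by (simp add: undirected_tree_def)
  interpret tree_graph T using assms(1) by unfold_locales
  let ?\<pi> = "fold_pebbling_number T t" and ?s = "support_size T D"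
  obtain k where t_eq: "t = Suc k" using assms(4) by (cases t) auto
  have \<pi>_eq: "?\<pi> = max_weight + k * 2 ^ d + 1" unfolding t_eq fold_pebbling_number_eq assms(2) ..
  have "k \<le> k * 2 ^ d" by simp
  moreover have "?s \<le> Suc k" using support_size_le_conf_size[of D] assms(3) t_eq by simp
  ultimately have support_le: "?s \<le> ?\<pi>" "max_weight + ?s \<le> ?\<pi>" unfolding \<pi>_eq by linarith+
  have "target_pebbling_number T D \<le> ?\<pi> - ?s + 1"
    unfolding target_pebbling_number_def
  proof (intro Least_le allI impI)
    fix C assume "?\<pi> - ?s + 1 \<le> conf_size T C"
    then have "ample D C" using \<pi>_eq support_le(1) t_eq assms(2,3) by (simp add: ample_def)
    then show "target_solvable T D C" using assms(3,4) by (intro target_solvable_ample) auto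
  qed
  then have "int (target_pebbling_number T D) \<le> int ?\<pi> - int ?s + 1" using support_le(1) by linarith
  moreover have "solves_with_cost_at_most T C v (2 ^ ecc T v)"
    if "int ?\<pi> - int ?s + 1 \<le> int (conf_size T C)" "v \<in> verts T" for C v
    using that support_le(2) weight_le_max_weight[of v] by (intro solves_with_cost_at_most_ecc) auto
  ultimately show ?thesis by blast
qed

end
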